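(* Let $A$ be an octonion division algebra with center $F$, let $n\geq 1$, and let $f(x)\in A[x]$ be a polynomial of degree $n$ with leading coefficient $c\in A\setminus\{0\}$. Then $f(x)$ factors into linear factors $$f(x)=((\dots(c(x-\lambda_n))\dots(x-\lambda_3))(x-\lambda_2))(x-\lambda_1)$$ for some $\lambda_1,\dots,\lambda_n\in A$ if and only if the companion polynomial $C_f(x)$ decomposes as $$C_f(x)=\operatorname{Norm}(c)\cdot\prod_{k=1}^n\left(x^2-\operatorname{Tr}(\gamma_k)x+\operatorname{Norm}(\gamma_k)\right)$$ for some $\gamma_1,\dots,\gamma_n\in A$. In that case, $\lambda_1,\dots,\lambda_n$ are, up to reordering, inner conjugates of $\gamma_1,\dots,\gamma_n$, and they represent the conjugacy classes of the roots of $f(x)$ (i.e., the set of conjugacy classes of the roots of $f(x)$ in $A$ is the set of conjugacy classes of $\lambda_1,\dots,\lambda_n$).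
   Context: An octonion algebra $A$ over a field $F$ (of any characteristic) is a Cayley-Dickson doubling $A=Q\oplus Q\ell$ of a quaternion algebra $Q$ over $F$, with multiplication $(q+r\ell)(s+t\ell)=qs+\gamma_0\overline{t}r+(r\overline{s}+tq)\ell$ for $q,r,s,t\in Q$, where $\gamma_0\in F^\times$ is fixed and $z\mapsto\overline{z}$ is the canonical involution of $Q$, extended to $A$ by $\overline{q+r\ell}=\overline{q}-r\ell$. The trace and norm maps $\operatorname{Tr},\operatorname{Norm}:A\to F$ are $\operatorname{Tr}(z)=z+\overline{z}$ and $\operatorname{Norm}(z)=\overline{z}z$; every $z\in A$ satisfies $z^2-\operatorname{Tr}(z)z+\operatorname{Norm}(z)=0$. The algebra $A$ is nonassociative but alternative (any two elements lie in an associative subalgebra). It is a division algebra if every nonzero element is invertible. Two elements $a,b\in A$ are (inner) conjugates if $b=zaz^{-1}$ for some nonzero $z\in A$; the conjugacy class of $a$ is the set of its inner conjugates. The ring of (central) polynomials is $A[x]=A\otimes_F F[x]$; the indeterminate $x$ commutes and associates with all elements, and every polynomial is written in the standard form $f(x)=c_nx^n+\dots+c_1x+c_0$ with coefficients $c_i\in A$ on the left. For $\lambda\in A$, $f(\lambda)$ denotes $c_n\lambda^n+\dots+c_1\lambda+c_0\in A$, and $\lambda$ is a root of $f(x)$ if $f(\lambda)=0$. The companion polynomial of $f(x)=c_nx^n+\dots+c_0\in A[x]$ is $C_f(x)=b_{2n}x^{2n}+\dots+b_1x+b_0\in F[x]$, where for odd $k$, $b_k=\sum_{0\leq i<j\leq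 n,\ i+j=k}\operatorname{Tr}(\overline{c_i}c_j)$, and for even $k=2m$, $b_k=\operatorname{Norm}(c_m)+\sum_{0\leq i<j\leq n,\ i+j=k}\operatorname{Tr}(\overline{c_i}c_j)$. Equivalently, $C_f(x)=\overline{f(x)}f(x)$ where $\overline{f(x)}=\overline{c_n}x^n+\dots+\overline{c_1}x+\overline{c_0}$. *)

theory Defs
  imports
    "HOL-Computational_Algebra.Polynomial"
    "HOL-Library.Product_Plus"
    "HOL-Combinatorics.Permutations"
begin

text \<open>
  A quaternion algebra over a field of arbitrary characteristic is a central simple algebra of
  dimension 4. Its canonical involution is the only linear anti-automorphism \<open>bar\<close> of
  order at most 2 for which all \<open>x + bar x\<close> and \<open>bar x * x\<close> are scalars
  (uniqueness is proved below), so taking it as a parameter is no loss of generality.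
\<close>

locale quaternion_algebra = vector_space scale
  for scale :: "'f::field \<Rightarrow> 'q::ring_1 \<Rightarrow> 'q" (infixr \<open>*q\<close> 75) +
  fixes bar :: "'q \<Rightarrow> 'q"
  assumes scale_mult_left: "(a *q x) * y = a *q (x * y)"
    and scale_mult_right: "x * (a *q y) = a *q (x * y)"
    and dim_4: "dim (UNIV :: 'q set) = 4"
    and central: "(\<forall>y. x * y = y * x) \<Longrightarrow> \<exists>a. x = a *q 1"
    and simple: "\<lbrakk>0 \<in> I; \<forall>x\<in>I. \<forall>y\<in>I. x + y \<in> I; \<forall>x\<in>I. \<forall>y. y * x \<in> I \<and> x * y \<in> I\<rbrakk>
      \<Longrightarrow> I = {0} \<or> I = (UNIV :: 'q set)"
    and bar_add: "bar (x + y) = bar x + bar y"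
    and bar_scale: "bar (a *q x) = a *q bar x"
    and bar_mult: "bar (x * y) = bar y * bar x"
    and bar_bar: "bar (bar x) = x"
    and bar_trace: "\<exists>a. x + bar x = a *q 1"
    and bar_norm: "\<exists>a. bar x * x = a *q 1"
begin

lemma scale_one_inject: "a *q (1::'q) = b *q 1 \<longleftrightarrow> a = b"
  using scale_cancel_right[of a 1 b] by simp

lemma bar_one: "bar 1 = 1"
  by (metis bar_bar bar_mult mult.left_neutral mult.right_neutral)

end

lemma canonical_involution_unique:
  assumes "quaternion_algebra scale bar" and "quaternion_algebra scale bar'"
  shows "bar = bar'"
proof
  interpret A: quaternion_algebra scale bar by fact
  interpret B: quaternion_algebra scale bar' by fact
  fix x
  obtain s where s: "x + bar x = scale s 1" using A.bar_trace by blast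
  obtain m where m: "bar x * x = scale m 1" using A.bar_norm by blast
  obtain t where t: "x + bar' x = scale t 1" using B.bar_trace by blast
  obtain k where k: "bar' x * x = scale k 1" using B.bar_norm by blast
  have 1: "x * x + scale m 1 = scale s x"
    by (metis m s A.scale_mult_left distrib_right mult.left_neutral)
  have 2: "x * x + scale k 1 = scale t x"
    by (metis k t A.scale_mult_left distrib_right mult.left_neutral)
  have e: "scale (s - t) x = scale (m - k) 1"
    unfolding A.scale_left_diff_distrib 1[symmetric] 2[symmetric] by simp
  show "bar x = bar' x"
  proof (cases "s = t")
    case True
    then show ?thesis using s t by (metis add_left_cancel)
  next
    case False
    then have "x = scale (inverse (s - t)) (scale (s - t) x)" by simp
    then have "x = scale (inverse (s - t) * (m - k)) 1" using e by simp
    then show ?thesis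
      by (metis A.bar_scale B.bar_scale A.bar_one B.bar_one)
  qed
qed

text \<open>The Cayley-Dickson double, with \<open>(q, r)\<close> standing for $q + r\ell$.\<close>

locale octonion_algebra = quaternion_algebra scale bar
  for scale :: "'f::field \<Rightarrow> 'q::ring_1 \<Rightarrow> 'q" (infixr \<open>*q\<close> 75) and bar :: "'q \<Rightarrow> 'q" +
  fixes \<gamma>\<^sub>0 :: 'f
  assumes gamma_nonzero: "\<gamma>\<^sub>0 \<noteq> 0"
begin

definition omult :: "'q \<times> 'q \<Rightarrow> 'q \<times> 'q \<Rightarrow> 'q \<times> 'q" (infixl \<open>\<otimes>\<close> 70) where
  "a \<otimes> b = (case (a, b) of ((q, r), (s, t)) \<Rightarrow>
     (q * s + \<gamma>\<^sub>0 *q (bar t * r), r * bar s + t * q))"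

definition scalar :: "'f \<Rightarrow> 'q \<times> 'q" where
  "scalar a = (a *q 1, 0)"

definition oone :: "'q \<times> 'q" (\<open>\<one>\<close>) where
  "\<one> = (1, 0)"

definition obar :: "'q \<times> 'q \<Rightarrow> 'q \<times> 'q" where
  "obar z = (bar (fst z), - snd z)"

definition Tr :: "'q \<times> 'q \<Rightarrow> 'f" where
  "Tr z = (THE a. z + obar z = scalar a)"

definition Norm :: "'q \<times> 'q \<Rightarrow> 'f" where
  "Norm z = (THE a. obar z \<otimes> z = scalar a)"

definition inner_conjugate :: "'q \<times> 'q \<Rightarrow> 'q \<times> 'q \<Rightarrow> bool" where
  "inner_conjugate a b \<longleftrightarrow>
     (\<exists>z w. z \<noteq> 0 \<and> z \<otimes> w = \<one> \<and> w \<otimes> z = \<one> \<and> b = z \<otimes> a \<otimes> w)"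

definition conjugacy_class :: "'q \<times> 'q \<Rightarrow> ('q \<times> 'q) set" where
  "conjugacy_class a = {b. inner_conjugate a b}"

primrec opower :: "'q \<times> 'q \<Rightarrow> nat \<Rightarrow> 'q \<times> 'q" where
  "opower a 0 = \<one>"
| "opower a (Suc k) = opower a k \<otimes> a"

text \<open>
  Octonion polynomials are elements of the type \<open>('q \<times> 'q) poly\<close>, which provides
  the additive structure only; the product with central indeterminate is \<open>opoly_mult\<close>.
\<close>

definition opoly_mult ::
  "('q \<times> 'q) poly \<Rightarrow> ('q \<times> 'q) poly \<Rightarrow> ('q \<times> 'q) poly" (infixl \<open>\<odot>\<close> 70) where
  "f \<odot> g = (\<Sum>i\<le>degree f. \<Sum>j\<le>degree g. monom (coeff f i \<otimes> coeff g j) (i + j))"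

definition oeval :: "('q \<times> 'q) poly \<Rightarrow> 'q \<times> 'q \<Rightarrow> 'q \<times> 'q" where
  "oeval f a = (\<Sum>i\<le>degree f. coeff f i \<otimes> opower a i)"

definition oroots :: "('q \<times> 'q) poly \<Rightarrow> ('q \<times> 'q) set" where
  "oroots f = {a. oeval f a = 0}"

text \<open>The left-nested product $((c (x - \lambda_n)) \cdots (x - \lambda_2)) (x - \lambda_1)$.\<close>

definition linear_product :: "'q \<times> 'q \<Rightarrow> (nat \<Rightarrow> 'q \<times> 'q) \<Rightarrow> nat \<Rightarrow> ('q \<times> 'q) poly" where
  "linear_product c lam n = foldl (\<lambda>p k. p \<odot> [:- lam k, \<one>:]) [:c:] (rev [1..<Suc n])"

definition companion_coeff :: "('q \<times> 'q) poly \<Rightarrow> nat \<Rightarrow> 'f" where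
  "companion_coeff f k =
     (if even k then Norm (coeff f (k div 2)) else 0) +
     (\<Sum>(i, j) \<in> {(i, j). i < j \<and> j \<le> degree f \<and> i + j = k}.
        Tr (obar (coeff f i) \<otimes> coeff f j))"

definition companion :: "('q \<times> 'q) poly \<Rightarrow> 'f poly" where
  "companion f = (\<Sum>k\<le>2 * degree f. monom (companion_coeff f k) k)"

lemma scalar_inject: "scalar a = scalar b \<longleftrightarrow> a = b"
  by (simp add: scalar_def scale_one_inject)

lemma scalar_Tr: "scalar (Tr z) = z + obar z"
proof -
  obtain a where "fst z + bar (fst z) = a *q 1" using bar_trace by blast
  then have a: "z + obar z = scalar a"
    by (cases z) (simp add: obar_def scalar_def)
  then show ?thesis
    unfolding Tr_def by (rule theI2) (auto simp: a scalar_inject)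
qed

lemma scalar_Norm: "scalar (Norm z) = obar z \<otimes> z"
proof -
  obtain q r where z: "z = (q, r)" by (cases z)
  obtain a b where "bar q * q = a *q 1" "bar r * r = b *q 1"
    using bar_norm by blast
  then have a: "obar z \<otimes> z = scalar (a - \<gamma>\<^sub>0 * b)"
    by (simp add: z obar_def omult_def scalar_def scale_left_diff_distrib)
  then show ?thesis
    unfolding Norm_def by (rule theI2) (auto simp: a scalar_inject)
qed

end

locale octonion_division_algebra = octonion_algebra +
  assumes invertible: "z \<noteq> 0 \<Longrightarrow> \<exists>w. z \<otimes> w = \<one> \<and> w \<otimes> z = \<one>"

end

theory Submission
  imports Defs
begin

text \<open>
  To each octonion \<open>z\<close> belongs the central polynomial \<open>char_poly z\<close>, which is
  $x^2 - \mathrm{Tr}(z)x + \mathrm{Norm}(z)$.  In a division algebra it determines the conjugacy class of \<open>z\<close>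
  (\<open>inner_conjugate_iff\<close>), so the theorem is a statement about the factors \<open>char_poly z\<close>
  of companion polynomials.  Three facts carry it.

  The companion polynomial behaves like a norm: appending a factor $x - \lambda$ on the right
  multiplies it by \<open>char_poly \<lambda>\<close> (\<open>companion_opoly_mult_linear\<close>).  Hence the companion polynomial of a
  product of linear factors has the required form.

  Conversely, if \<open>char_poly z\<close> divides the companion polynomial of \<open>f\<close>, then \<open>f\<close> has a root in
  the class of \<open>z\<close> (\<open>ex_root_if_char_poly_dvd_companion\<close>): modulo \<open>char_poly z\<close>, \<open>f\<close> is a linear
  polynomial $ax + b$, and its root $-a^{-1}b$ turns out to have the trace and norm of \<open>z\<close>.
  A root $\lambda$ of \<open>f\<close> gives a right factor $x - \lambda$ by synthetic division, for which
  associativity in the form $(y\lambda)\lambda^k = y\lambda^{k+1}$ suffices.  Dividing by it and cancelling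
  \<open>char_poly \<lambda>\<close> from the companion polynomial, one factors \<open>f\<close> completely by induction.

  Finally, factorizations into polynomials of the form \<open>char_poly z\<close> are unique
  (\<open>char_poly_factorization_unique\<close>), even when such a polynomial is the square $(x - z)^2$ for a scalar
  \<open>z\<close>.  The reason is that an octonion algebra without zero divisors allows one to
  evaluate at \<open>z\<close>: if \<open>char_poly z\<close> divides a product of such polynomials, then one of the factors vanishes
  at \<open>z\<close> and must be \<open>char_poly z\<close>.  This gives the matching of the $\lambda_k$ with the
  $\gamma_k$.  As the classes of roots of \<open>f\<close> are those of all \<open>z\<close> for which \<open>char_poly z\<close>
  divides the companion polynomial, it also identifies them.
\<close>

section \<open>Trace and norm of quaternions\<close>

context quaternion_algebra begin

definition qtr :: "'q \<Rightarrow> 'f" where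
  "qtr x = (SOME a. x + bar x = a *q 1)"

definition qnorm :: "'q \<Rightarrow> 'f" where
  "qnorm x = (SOME a. bar x * x = a *q 1)"

lemma add_bar: "x + bar x = qtr x *q 1"
  unfolding qtr_def by (rule someI_ex) (rule bar_trace)

lemma bar_mult_self: "bar x * x = qnorm x *q 1"
  unfolding qnorm_def by (rule someI_ex) (rule bar_norm)

lemma qtr_eqI: "x + bar x = a *q 1 \<Longrightarrow> qtr x = a"
  using add_bar[of x] by (simp add: scale_one_inject)

lemma qnorm_eqI: "bar x * x = a *q 1 \<Longrightarrow> qnorm x = a"
  using bar_mult_self[of x] by (simp add: scale_one_inject)

lemma bar_zero [simp]: "bar 0 = 0"
  using bar_add[of 0 0] by simp

lemma bar_minus: "bar (- x) = - bar x"
  using bar_add[of x "- x"] by (simp add: eq_neg_iff_add_eq_0 add.commute)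

lemma bar_diff: "bar (x - y) = bar x - bar y"
  using bar_add[of x "- y"] by (simp add: bar_minus)

lemma self_mult_bar: "x * bar x = qnorm x *q 1"
proof -
  have "bar x = qtr x *q 1 - x"
    using add_bar[of x] by (simp add: eq_diff_eq add.commute)
  then have "x * bar x = bar x * x"
    by (simp only: right_diff_distrib left_diff_distrib scale_mult_left scale_mult_right) simp
  then show ?thesis by (simp add: bar_mult_self)
qed

lemma bar_mult_cancel: "bar x * (x * y) = qnorm x *q y" "x * (bar x * y) = qnorm x *q y"
  by (simp_all add: mult.assoc[symmetric] bar_mult_self self_mult_bar scale_mult_left)

lemma qtr_add: "qtr (x + y) = qtr x + qtr y"
  by (rule qtr_eqI)
    (simp add: bar_add scale_left_distrib add_bar[symmetric] algebra_simps)

lemma qtr_scale: "qtr (a *q x) = a * qtr x"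
  by (rule qtr_eqI)
    (simp add: bar_scale scale_right_distrib[symmetric] add_bar)

lemma qtr_bar: "qtr (bar x) = qtr x"
  by (rule qtr_eqI) (simp add: bar_bar add.commute add_bar)

text \<open>Symmetry of the trace is the polarization of \<open>z * bar z = bar z * z\<close>
  at \<open>z = x + bar y\<close>.\<close>

lemma qtr_mult_commute: "qtr (x * y) = qtr (y * x)"
proof (rule qtr_eqI)
  let ?z = "x + bar y"
  have "?z * bar ?z = bar ?z * ?z"
    by (simp only: bar_mult_self self_mult_bar)
  moreover have "?z * bar ?z = (x * y + bar (x * y)) + (qnorm x + qnorm y) *q 1"
    by (simp add: bar_add bar_bar bar_mult algebra_simps self_mult_bar bar_mult_self)
  moreover have "bar ?z * ?z = (y * x + bar (y * x)) + (qnorm x + qnorm y) *q 1"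
    by (simp add: bar_add bar_bar bar_mult algebra_simps self_mult_bar bar_mult_self)
  ultimately have "x * y + bar (x * y) = y * x + bar (y * x)" by simp
  then show "x * y + bar (x * y) = qtr (y * x) *q 1"
    by (simp add: add_bar)
qed

lemma qnorm_bar: "qnorm (bar x) = qnorm x"
  by (rule qnorm_eqI) (simp add: bar_bar self_mult_bar)

lemma qnorm_scale: "qnorm (a *q x) = a * a * qnorm x"
  by (rule qnorm_eqI)
    (simp add: bar_scale scale_mult_left scale_mult_right bar_mult_self mult.assoc)

lemma qnorm_mult: "qnorm (x * y) = qnorm x * qnorm y"
proof (rule qnorm_eqI)
  have "bar (x * y) * (x * y) = bar y * (bar x * (x * y))"
    by (simp add: bar_mult mult.assoc)
  then show "bar (x * y) * (x * y) = (qnorm x * qnorm y) *q 1"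
    by (simp add: bar_mult_cancel scale_mult_right bar_mult_self)
qed

lemma qnorm_add: "qnorm (x + y) = qnorm x + qnorm y + qtr (bar x * y)"
proof (rule qnorm_eqI)
  have "bar x * y + bar (bar x * y) = qtr (bar x * y) *q 1" by (rule add_bar)
  then show "bar (x + y) * (x + y) = (qnorm x + qnorm y + qtr (bar x * y)) *q 1"
    by (simp add: bar_add bar_mult bar_bar algebra_simps bar_mult_self)
qed

text \<open>If \<open>bar\<close> were the identity, then \<open>'q\<close> would be commutative, hence equal to its
  center, which has dimension 1.\<close>

lemma ex_bar_neq: "\<exists>x :: 'q. bar x \<noteq> x"
proof (rule ccontr)
  assume "\<nexists>x :: 'q. bar x \<noteq> x"
  then have comm: "x * y = y * x" for x y :: 'q
    using bar_mult[of x y] by simp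
  have "x \<in> span {1}" for x :: 'q
  proof -
    obtain a where "x = a *q 1" using central[of x] comm by blast
    then show ?thesis by (simp add: span_base span_scale)
  qed
  then have "dim (UNIV :: 'q set) \<le> card {1 :: 'q}"
    by (intro dim_le_card) auto
  then show False by (simp add: dim_4)
qed

end

section \<open>Octonions: trace, norm and alternativity\<close>

context octonion_algebra begin

definition osmul :: "'f \<Rightarrow> 'q \<times> 'q \<Rightarrow> 'q \<times> 'q" (infixr \<open>\<cdot>\<close> 75) where
  "a \<cdot> z = (a *q fst z, a *q snd z)"

lemma scalar_eq_osmul: "scalar a = a \<cdot> \<one>"
  by (simp add: scalar_def osmul_def oone_def)

lemma osmul_simps [simp]:
  "0 \<cdot> z = 0" "a \<cdot> 0 = 0" "1 \<cdot> z = z" "a \<cdot> b \<cdot> z = (a * b) \<cdot> z"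
  by (simp_all add: osmul_def prod_eq_iff)

lemma osmul_distribs:
  "a \<cdot> (x + y) = a \<cdot> x + a \<cdot> y" "a \<cdot> (x - y) = a \<cdot> x - a \<cdot> y" "a \<cdot> (- x) = - (a \<cdot> x)"
  "(a + b) \<cdot> x = a \<cdot> x + b \<cdot> x" "(a - b) \<cdot> x = a \<cdot> x - b \<cdot> x" "(- a) \<cdot> x = - (a \<cdot> x)"
  by (simp_all add: osmul_def prod_eq_iff scale_right_distrib scale_left_distrib
      scale_right_diff_distrib scale_left_diff_distrib)

lemma omult_distribs:
  "x \<otimes> (y + z) = x \<otimes> y + x \<otimes> z" "(x + y) \<otimes> z = x \<otimes> z + y \<otimes> z"
  "x \<otimes> (y - z) = x \<otimes> y - x \<otimes> z" "(x - y) \<otimes> z = x \<otimes> z - y \<otimes> z"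
  "x \<otimes> (- y) = - (x \<otimes> y)" "(- x) \<otimes> y = - (x \<otimes> y)"
  by (simp_all add: omult_def prod_eq_iff split_beta bar_add bar_diff bar_minus algebra_simps
      scale_right_distrib scale_right_diff_distrib)

lemma omult_zero [simp]: "x \<otimes> 0 = 0" "0 \<otimes> x = 0"
  by (simp_all add: omult_def prod_eq_iff split_beta)

lemma omult_osmul [simp]: "a \<cdot> x \<otimes> y = a \<cdot> (x \<otimes> y)" "x \<otimes> a \<cdot> y = a \<cdot> (x \<otimes> y)"
  by (simp_all add: omult_def osmul_def prod_eq_iff split_beta bar_scale scale_mult_left
      scale_mult_right scale_right_distrib mult.commute)

lemma omult_one [simp]: "\<one> \<otimes> x = x" "x \<otimes> \<one> = x"
  by (simp_all add: omult_def oone_def prod_eq_iff split_beta bar_one)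

lemma omult_sum: "x \<otimes> sum g S = (\<Sum>i\<in>S. x \<otimes> g i)" "sum g S \<otimes> x = (\<Sum>i\<in>S. g i \<otimes> x)"
  by (induction S rule: infinite_finite_induct) (simp_all add: omult_distribs)

lemma omult_scalar [simp]: "scalar a \<otimes> x = a \<cdot> x" "x \<otimes> scalar a = a \<cdot> x"
  by (simp_all add: scalar_eq_osmul)

lemma obar_simps [simp]:
  "obar (obar x) = x" "obar 0 = 0" "obar \<one> = \<one>" "obar (a \<cdot> x) = a \<cdot> obar x"
  by (simp_all add: obar_def oone_def osmul_def prod_eq_iff bar_bar bar_one bar_scale)

lemma obar_distribs:
  "obar (x + y) = obar x + obar y" "obar (x - y) = obar x - obar y" "obar (- x) = - obar x"
  by (simp_all add: obar_def prod_eq_iff bar_add bar_diff bar_minus)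

lemma obar_omult: "obar (x \<otimes> y) = obar y \<otimes> obar x"
  by (simp add: obar_def omult_def prod_eq_iff split_beta bar_add bar_mult bar_scale bar_minus
      bar_bar algebra_simps)

lemma scalar_add: "scalar (a + b) = scalar a + scalar b"
  and scalar_diff: "scalar (a - b) = scalar a - scalar b"
  and scalar_mult: "scalar (a * b) = a \<cdot> scalar b"
  and scalar_zero [simp]: "scalar 0 = 0"
  and scalar_one: "scalar 1 = \<one>"
  by (simp_all add: scalar_eq_osmul osmul_distribs)

lemma scalar_sum: "scalar (sum g S) = (\<Sum>i\<in>S. scalar (g i))"
  by (induction S rule: infinite_finite_induct) (simp_all add: scalar_add)

lemma Tr_eq_qtr: "Tr z = qtr (fst z)"
proof -
  have "scalar (Tr z) = scalar (qtr (fst z))"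
    unfolding scalar_Tr by (simp add: obar_def scalar_def prod_eq_iff add_bar)
  then show ?thesis by (simp add: scalar_inject)
qed

lemma Norm_eq_qnorm: "Norm z = qnorm (fst z) - \<gamma>\<^sub>0 * qnorm (snd z)"
proof -
  have "scalar (Norm z) = scalar (qnorm (fst z) - \<gamma>\<^sub>0 * qnorm (snd z))"
    unfolding scalar_Norm
    by (simp add: obar_def omult_def scalar_def prod_eq_iff split_beta bar_mult_self
        scale_left_diff_distrib)
  then show ?thesis by (simp add: scalar_inject)
qed

lemma Tr_simps:
  "Tr (x + y) = Tr x + Tr y" "Tr (a \<cdot> x) = a * Tr x" "Tr (obar x) = Tr x" "Tr 0 = 0"
  by (simp_all add: Tr_eq_qtr qtr_add osmul_def qtr_scale obar_def qtr_bar)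
    (use qtr_scale[of 0 0] in simp)

lemma Tr_minus: "Tr (- x) = - Tr x"
  using Tr_simps(1)[of x "- x"] by (simp add: Tr_simps(4) eq_neg_iff_add_eq_0 add.commute)

lemma Tr_sum: "Tr (sum g S) = (\<Sum>i\<in>S. Tr (g i))"
  by (induction S rule: infinite_finite_induct) (simp_all add: Tr_simps)

lemma Tr_omult_commute: "Tr (x \<otimes> y) = Tr (y \<otimes> x)"
proof -
  have "qtr (bar t * r) = qtr (bar r * t)" for r t
    using qtr_bar[of "bar t * r"] by (simp add: bar_mult bar_bar)
  then show ?thesis
    by (simp add: Tr_eq_qtr omult_def split_beta qtr_add qtr_scale qtr_mult_commute)
qed

text \<open>Octonions do not associate, but their products do under the trace: this is what lets scalars
  be pulled out of a product of three factors in \<open>opoly_mult_obar_linear_term\<close> below.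
  Expanding both sides gives four trace terms, which agree up to a cyclic rotation.\<close>

lemma Tr_omult_assoc: "Tr (x \<otimes> y \<otimes> z) = Tr (x \<otimes> (y \<otimes> z))"
proof -
  obtain q r where x: "x = (q, r)" by (cases x)
  obtain s t where y: "y = (s, t)" by (cases y)
  obtain u v where z: "z = (u, v)" by (cases z)
  have "qtr (bar t * (r * u)) = qtr (u * (bar t * r))"
       "qtr (bar v * (r * bar s)) = qtr (bar s * (bar v * r))"
       "qtr (bar v * (t * q)) = qtr (q * (bar v * t))"
    using qtr_mult_commute[of "bar t * r" u] qtr_mult_commute[of "bar v * r" "bar s"]
      qtr_mult_commute[of "bar v * t" q] by (simp_all add: mult.assoc)
  then show ?thesis
    by (simp add: x y z Tr_eq_qtr omult_def qtr_add qtr_scale bar_add bar_mult bar_bar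
        algebra_simps scale_mult_left scale_mult_right scale_right_distrib)
qed

lemma Norm_osmul: "Norm (a \<cdot> x) = a * a * Norm x"
  by (simp add: Norm_eq_qnorm osmul_def qnorm_scale algebra_simps)

lemma Norm_obar: "Norm (obar x) = Norm x"
  using qnorm_scale[of "-1" "snd x"] by (simp add: Norm_eq_qnorm obar_def qnorm_bar)

lemma Norm_minus: "Norm (- x) = Norm x"
  using Norm_osmul[of "-1" x] by (simp add: osmul_distribs)

lemma Norm_zero [simp]: "Norm 0 = 0"
  using Norm_osmul[of 0 0] by simp

lemma Norm_one: "Norm \<one> = 1"
  using scalar_Norm[of \<one>] by (simp add: scalar_one flip: scalar_inject)

text \<open>The norm is $N(q, r) = N(q) - \gamma_0 N(r)$ in terms of the quaternion norm.  In
  the expansion of the norm of a product the two mixed terms are traces of conjugate elements, up to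
  a cyclic rotation, and cancel.\<close>

lemma Norm_omult: "Norm (x \<otimes> y) = Norm x * Norm y"
proof -
  obtain q r where x: "x = (q, r)" by (cases x)
  obtain s t where y: "y = (s, t)" by (cases y)
  have "qtr (bar (q * s) * (bar t * r)) = qtr (bar (bar (q * s) * (bar t * r)))"
    by (simp add: qtr_bar)
  also have "\<dots> = qtr ((bar r * (t * q)) * s)"
    by (simp add: bar_mult bar_bar mult.assoc)
  also have "\<dots> = qtr (bar (r * bar s) * (t * q))"
    by (subst qtr_mult_commute) (simp add: bar_mult bar_bar mult.assoc)
  finally have "qtr (bar (q * s) * (bar t * r)) = qtr (bar (r * bar s) * (t * q))" .
  moreover have "qtr (bar (t * q) * (r * bar s)) = qtr (bar (r * bar s) * (t * q))"
    using qtr_bar[of "bar (t * q) * (r * bar s)"] by (simp add: bar_mult[of "bar (t * q)"] bar_bar)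
  ultimately show ?thesis
    by (simp add: x y Norm_eq_qnorm omult_def qnorm_add qnorm_scale qnorm_mult qnorm_bar
        qtr_scale scale_mult_right algebra_simps)
qed

lemma Norm_add: "Norm (x + y) = Norm x + Norm y + Tr (obar x \<otimes> y)"
proof -
  have "scalar (Tr (obar x \<otimes> y)) = obar x \<otimes> y + obar y \<otimes> x"
    by (simp add: scalar_Tr obar_omult)
  then have "scalar (Norm (x + y)) = scalar (Norm x + Norm y + Tr (obar x \<otimes> y))"
    by (simp add: scalar_Norm scalar_add obar_distribs omult_distribs algebra_simps)
  then show ?thesis by (simp add: scalar_inject)
qed

text \<open>This polarizes the multiplicativity of the norm.\<close>

lemma Tr_obar_omult_right:
  "Tr (obar (x \<otimes> z) \<otimes> (y \<otimes> z)) = Norm z * Tr (obar x \<otimes> y)"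
  using Norm_add[of "x \<otimes> z" "y \<otimes> z"] Norm_add[of x y]
  by (simp add: omult_distribs(2)[symmetric] Norm_omult algebra_simps)

text \<open>Alternativity enters through this identity of Kirmse: replacing \<open>obar x\<close> by
  \<open>Tr x \<cdot> \<one> - x\<close> turns it into a rewrite rule for \<open>y \<otimes> x \<otimes> x\<close>.\<close>

lemma omult_obar_cancel_right: "y \<otimes> x \<otimes> obar x = Norm x \<cdot> y"
proof -
  obtain s t where x: "x = (s, t)" by (cases x)
  obtain q r where y: "y = (q, r)" by (cases y)
  have "(q * s + \<gamma>\<^sub>0 *q (bar t * r)) * bar s + \<gamma>\<^sub>0 *q (bar (- t) * (r * bar s + t * q))
      = q * (s * bar s) - \<gamma>\<^sub>0 *q (bar t * t * q)"
    by (simp add: bar_minus distrib_left distrib_right scale_mult_left scale_right_distrib scale_right_diff_distrib scale_minus_right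
        mult.assoc)
  also have "\<dots> = (qnorm s - \<gamma>\<^sub>0 * qnorm t) *q q"
    by (simp add: self_mult_bar bar_mult_self scale_mult_left scale_mult_right
        scale_left_diff_distrib)
  finally have 1: "(q * s + \<gamma>\<^sub>0 *q (bar t * r)) * bar s
      + \<gamma>\<^sub>0 *q (bar (- t) * (r * bar s + t * q)) = (qnorm s - \<gamma>\<^sub>0 * qnorm t) *q q" .
  have "(r * bar s + t * q) * bar (bar s) + - t * (q * s + \<gamma>\<^sub>0 *q (bar t * r))
      = r * (bar s * s) - \<gamma>\<^sub>0 *q (t * bar t * r)"
    by (simp add: bar_bar distrib_left distrib_right scale_mult_right mult.assoc)
  also have "\<dots> = (qnorm s - \<gamma>\<^sub>0 * qnorm t) *q r"
    by (simp add: self_mult_bar bar_mult_self scale_mult_left scale_mult_right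
        scale_left_diff_distrib)
  finally have 2: "(r * bar s + t * q) * bar (bar s) + - t * (q * s + \<gamma>\<^sub>0 *q (bar t * r))
      = (qnorm s - \<gamma>\<^sub>0 * qnorm t) *q r" .
  show ?thesis
    unfolding x y omult_def obar_def osmul_def Norm_eq_qnorm using 1 2 by simp
qed

lemma omult_obar_cancel_left: "obar x \<otimes> (x \<otimes> y) = Norm x \<cdot> y" "x \<otimes> (obar x \<otimes> y) = Norm x \<cdot> y"
  using arg_cong[OF omult_obar_cancel_right[of "obar y" "obar x"], of obar]
    arg_cong[OF omult_obar_cancel_right[of "obar y" x], of obar]
  by (simp_all add: obar_omult Norm_obar)

lemma omult_obar_self: "x \<otimes> obar x = Norm x \<cdot> \<one>" "obar x \<otimes> x = Norm x \<cdot> \<one>"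
  using omult_obar_cancel_right[of \<one> x] omult_obar_cancel_left[of x \<one>] by simp_all

lemma obar_eq: "obar x = Tr x \<cdot> \<one> - x"
  using scalar_Tr[of x] by (simp add: scalar_eq_osmul algebra_simps)

lemma omult_self: "x \<otimes> x = Tr x \<cdot> x - Norm x \<cdot> \<one>"
  using omult_obar_self(1)[of x] by (simp add: obar_eq omult_distribs algebra_simps)

lemma omult_omult_self: "y \<otimes> x \<otimes> x = Tr x \<cdot> (y \<otimes> x) - Norm x \<cdot> y"
  using omult_obar_cancel_right[of y x] by (simp add: obar_eq omult_distribs algebra_simps)

section \<open>Octonion polynomials and their products with linear factors\<close>

lemma coeff_opoly_mult: "coeff (f \<odot> g) k = (\<Sum>i\<le>k. coeff f i \<otimes> coeff g (k - i))"
proof -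
  have inner: "(\<Sum>j\<le>degree g. if i + j = k then coeff f i \<otimes> coeff g j else 0) =
      (if i \<le> k then coeff f i \<otimes> coeff g (k - i) else 0)" (is "?l = ?r") for i
  proof (cases "i \<le> k")
    case True
    then have "?l = (\<Sum>j\<le>degree g. if j = k - i then coeff f i \<otimes> coeff g j else 0)"
      by (intro sum.cong) auto
    with True show ?thesis by (auto simp: coeff_eq_0)
  qed auto
  have "coeff (f \<odot> g) k = (\<Sum>i\<le>degree f. if i \<le> k then coeff f i \<otimes> coeff g (k - i) else 0)"
    unfolding opoly_mult_def by (simp add: coeff_sum inner)
  also have "\<dots> = (\<Sum>i\<le>k. coeff f i \<otimes> coeff g (k - i))"
    unfolding sum.inter_filter[OF finite_atMost, symmetric]
    by (rule sum.mono_neutral_left) (auto intro!: le_degree)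
  finally show ?thesis .
qed

lemma opoly_mult_distribs:
  "f \<odot> (g + h) = f \<odot> g + f \<odot> h" "(f + g) \<odot> h = f \<odot> h + g \<odot> h"
  "f \<odot> (g - h) = f \<odot> g - f \<odot> h" "(f - g) \<odot> h = f \<odot> h - g \<odot> h"
  by (simp_all add: poly_eq_iff coeff_opoly_mult omult_distribs sum.distrib sum_subtractf)

lemma opoly_mult_pCons_0:
  "pCons 0 f \<odot> g = pCons 0 (f \<odot> g)" "f \<odot> pCons 0 g = pCons 0 (f \<odot> g)"
proof -
  show "pCons 0 f \<odot> g = pCons 0 (f \<odot> g)"
  proof (rule poly_eqI)
    fix k show "coeff (pCons 0 f \<odot> g) k = coeff (pCons 0 (f \<odot> g)) k"
      by (cases k) (simp_all add: coeff_opoly_mult sum.atMost_Suc_shift del: sum.atMost_Suc)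
  qed
  show "f \<odot> pCons 0 g = pCons 0 (f \<odot> g)"
  proof (rule poly_eqI)
    fix k show "coeff (f \<odot> pCons 0 g) k = coeff (pCons 0 (f \<odot> g)) k"
      by (cases k) (auto simp: coeff_opoly_mult Suc_diff_le intro!: sum.cong)
  qed
qed

lemma opoly_mult_const: "[:x:] \<odot> f = map_poly ((\<otimes>) x) f" "f \<odot> [:x:] = map_poly (\<lambda>y. y \<otimes> x) f"
proof -
  show "[:x:] \<odot> f = map_poly ((\<otimes>) x) f"
  proof (rule poly_eqI)
    fix k
    have "coeff ([:x:] \<odot> f) k = (\<Sum>i\<le>k. if i = 0 then x \<otimes> coeff f (k - i) else 0)"
      unfolding coeff_opoly_mult
      by (rule sum.cong) (auto simp: coeff_pCons split: nat.splits)
    then show "coeff ([:x:] \<odot> f) k = coeff (map_poly ((\<otimes>) x) f) k"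
      by (simp add: coeff_map_poly)
  qed
  show "f \<odot> [:x:] = map_poly (\<lambda>y. y \<otimes> x) f"
  proof (rule poly_eqI)
    fix k
    have "coeff (f \<odot> [:x:]) k = (\<Sum>i\<le>k. if i = k then coeff f i \<otimes> x else 0)"
      unfolding coeff_opoly_mult
      by (rule sum.cong) (auto simp: coeff_pCons split: nat.splits)
    then show "coeff (f \<odot> [:x:]) k = coeff (map_poly (\<lambda>y. y \<otimes> x) f) k"
      by (simp add: coeff_map_poly)
  qed
qed

lemma opoly_mult_linear: "f \<odot> [:- x, \<one>:] = pCons 0 f - map_poly (\<lambda>y. y \<otimes> x) f"
proof -
  have "[:- x, \<one>:] = pCons 0 [:\<one>:] - [:x:]" by simp
  then have "f \<odot> [:- x, \<one>:] = pCons 0 (f \<odot> [:\<one>:]) - f \<odot> [:x:]"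
    by (simp only: opoly_mult_distribs opoly_mult_pCons_0)
  then show ?thesis by (simp add: opoly_mult_const)
qed

lemma coeff_opoly_mult_linear:
  "coeff (f \<odot> [:- x, \<one>:]) k = (case k of 0 \<Rightarrow> 0 | Suc j \<Rightarrow> coeff f j) - coeff f k \<otimes> x"
  by (simp add: opoly_mult_linear coeff_map_poly coeff_pCons split: nat.split)

lemma degree_opoly_mult_linear:
  assumes "f \<noteq> 0"
  shows "degree (f \<odot> [:- x, \<one>:]) = Suc (degree f)"
    and "lead_coeff (f \<odot> [:- x, \<one>:]) = lead_coeff f"
proof -
  show d: "degree (f \<odot> [:- x, \<one>:]) = Suc (degree f)"
  proof (rule antisym)
    show "degree (f \<odot> [:- x, \<one>:]) \<le> Suc (degree f)"
      by (rule degree_le) (auto simp: coeff_opoly_mult_linear coeff_eq_0 split: nat.split)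
    show "Suc (degree f) \<le> degree (f \<odot> [:- x, \<one>:])"
      by (rule le_degree) (use assms in \<open>simp add: coeff_opoly_mult_linear coeff_eq_0\<close>)
  qed
  show "lead_coeff (f \<odot> [:- x, \<one>:]) = lead_coeff f"
    unfolding d by (simp add: coeff_opoly_mult_linear coeff_eq_0)
qed

section \<open>Quadratic central polynomials\<close>

text \<open>The minimal polynomial over the center if \<open>z\<close> is not a scalar, and the square of the minimal
  polynomial if it is: counted this way, every conjugacy class has a polynomial of degree 2.\<close>

definition char_poly :: "'q \<times> 'q \<Rightarrow> 'f poly" where
  "char_poly z = [:Norm z, - Tr z, 1:]"

lemma char_poly_eq_iff: "char_poly x = char_poly y \<longleftrightarrow> Norm x = Norm y \<and> Tr x = Tr y"
  by (auto simp: char_poly_def)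

lemma degree_char_poly [simp]: "degree (char_poly z) = 2"
  by (simp add: char_poly_def)

lemma char_poly_neq_0 [simp]: "char_poly z \<noteq> 0"
  using degree_char_poly[of z] by force

text \<open>The product of \<open>h\<close> with the central polynomial \<open>char_poly z\<close>, spelled out by shifts and scalings:
  both can be pulled out of either argument of \<open>\<odot>\<close>, and so can this operator.\<close>

definition char_poly_times :: "'q \<times> 'q \<Rightarrow> ('q \<times> 'q) poly \<Rightarrow> ('q \<times> 'q) poly" where
  "char_poly_times z h =
     pCons 0 (pCons 0 h) - pCons 0 (map_poly ((\<cdot>) (Tr z)) h) + map_poly ((\<cdot>) (Norm z)) h"

lemma coeff_map_osmul [simp]: "coeff (map_poly ((\<cdot>) a) f) k = a \<cdot> coeff f k"
  by (simp add: coeff_map_poly)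

lemma coeff_map_obar [simp]: "coeff (map_poly obar f) k = obar (coeff f k)"
  by (simp add: coeff_map_poly)

lemma coeff_map_scalar [simp]: "coeff (map_poly scalar p) k = scalar (coeff p k)"
  by (simp add: coeff_map_poly)

lemma map_scalar_add: "map_poly scalar (p + q) = map_poly scalar p + map_poly scalar q"
  and map_scalar_diff: "map_poly scalar (p - q) = map_poly scalar p - map_poly scalar q"
  by (simp_all add: poly_eq_iff scalar_add scalar_diff)

lemma map_scalar_inject: "map_poly scalar p = map_poly scalar q \<longleftrightarrow> p = q"
  by (simp add: poly_eq_iff scalar_inject)

lemma opoly_mult_osmul:
  "map_poly ((\<cdot>) a) f \<odot> g = map_poly ((\<cdot>) a) (f \<odot> g)"
  "f \<odot> map_poly ((\<cdot>) a) g = map_poly ((\<cdot>) a) (f \<odot> g)"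
proof -
  have "a \<cdot> sum h S = (\<Sum>i\<in>S. a \<cdot> h i)" for h and S :: "nat set"
    by (induction S rule: infinite_finite_induct) (simp_all add: osmul_distribs)
  then show "map_poly ((\<cdot>) a) f \<odot> g = map_poly ((\<cdot>) a) (f \<odot> g)"
    "f \<odot> map_poly ((\<cdot>) a) g = map_poly ((\<cdot>) a) (f \<odot> g)"
    by (simp_all add: poly_eq_iff coeff_opoly_mult)
qed

lemma char_poly_times_opoly_mult:
  "char_poly_times z f \<odot> g = char_poly_times z (f \<odot> g)"
  "f \<odot> char_poly_times z g = char_poly_times z (f \<odot> g)"
  by (simp_all only: char_poly_times_def opoly_mult_distribs opoly_mult_pCons_0 opoly_mult_osmul)

lemma char_poly_times_add: "char_poly_times z (f + g) = char_poly_times z f + char_poly_times z g"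
  by (simp add: char_poly_times_def poly_eq_iff coeff_pCons osmul_distribs split: nat.split)

lemma map_obar_char_poly_times:
  "map_poly obar (char_poly_times z f) = char_poly_times z (map_poly obar f)"
  by (simp add: char_poly_times_def poly_eq_iff coeff_pCons obar_distribs split: nat.split)

lemma map_scalar_char_poly_mult:
  "map_poly scalar (char_poly z * p) = char_poly_times z (map_poly scalar p)"
  by (simp add: char_poly_times_def char_poly_def poly_eq_iff coeff_pCons scalar_eq_osmul
      osmul_distribs algebra_simps split: nat.split)

text \<open>Division with remainder works as over a field since \<open>char_poly z\<close> is monic and central: in the
  induction step $x^2$ is replaced by $\mathrm{Tr}(z)x - \mathrm{Norm}(z)$.\<close>

lemma ex_char_poly_division: "\<exists>h a b. f = char_poly_times z h + [:b, a:]"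
proof (induction f)
  case 0
  have "0 = char_poly_times z 0 + [:0, 0:]" by (simp add: char_poly_times_def)
  then show ?case by blast
next
  case (pCons c f)
  then obtain h a b where f: "f = char_poly_times z h + [:b, a:]" by blast
  have "pCons c f = char_poly_times z (pCons a h) +
      [:c - Norm z \<cdot> a, b + Tr z \<cdot> a:]"
    by (simp add: f char_poly_times_def poly_eq_iff coeff_pCons algebra_simps split: nat.split)
  then show ?case by blast
qed

section \<open>The companion polynomial\<close>

text \<open>Without the bound by the degree, the sum is over an index set that is the same for all
  polynomials, so that coefficientwise operations on \<open>f\<close> can be followed under the sum.\<close>

lemma companion_coeff_eq:
  "companion_coeff f k = (if even k then Norm (coeff f (k div 2)) else 0) +
     (\<Sum>i | 2 * i < k. Tr (obar (coeff f i) \<otimes> coeff f (k - i)))"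
proof -
  let ?t = "\<lambda>i j. Tr (obar (coeff f i) \<otimes> coeff f j)"
  have "(\<Sum>(i, j) \<in> {(i, j). i < j \<and> j \<le> degree f \<and> i + j = k}. ?t i j)
      = (\<Sum>i | 2 * i < k \<and> k - i \<le> degree f. ?t i (k - i))"
    by (rule sum.reindex_bij_witness[of _ "\<lambda>i. (i, k - i)" fst]) auto
  also have "\<dots> = (\<Sum>i | 2 * i < k. ?t i (k - i))"
    by (rule sum.mono_neutral_left)
      (auto simp: Tr_simps intro!: le_degree intro: finite_subset[of _ "{..k}"])
  finally show ?thesis by (simp add: companion_coeff_def)
qed

text \<open>In the convolution the terms with indices \<open>i\<close> and \<open>k - i\<close> are conjugate
  to each other, so each such pair contributes a trace.\<close>

lemma scalar_companion_coeff:
  "scalar (companion_coeff f k) = (\<Sum>i\<le>k. obar (coeff f i) \<otimes> coeff f (k - i))"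
proof -
  let ?t = "\<lambda>i. obar (coeff f i) \<otimes> coeff f (k - i)"
  let ?L = "{i. 2 * i < k}" and ?M = "{i. 2 * i = k}" and ?R = "{i. k < 2 * i \<and> i \<le> k}"
  have fin: "finite ?L" "finite ?M" "finite ?R"
    by (auto intro: finite_subset[of _ "{..k}"])
  have "{..k} = ?L \<union> ?M \<union> ?R" by auto
  then have "sum ?t {..k} = sum ?t (?L \<union> ?M \<union> ?R)" by simp
  also have "\<dots> = sum ?t (?L \<union> ?M) + sum ?t ?R"
    by (rule sum.union_disjoint) (use fin in auto)
  also have "sum ?t (?L \<union> ?M) = sum ?t ?L + sum ?t ?M"
    by (rule sum.union_disjoint) (use fin in auto)
  also have "sum ?t ?R = (\<Sum>i\<in>?L. obar (?t i))"
    by (rule sum.reindex_bij_witness[of _ "\<lambda>i. k - i" "\<lambda>i. k - i"]) (auto simp: obar_omult)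
  also have "sum ?t ?M = (if even k then scalar (Norm (coeff f (k div 2))) else 0)"
  proof (cases "even k")
    case True
    then obtain m where "k = 2 * m" by auto
    then show ?thesis by (simp add: scalar_Norm)
  next
    case False
    then have "?M = {}" by auto
    with False show ?thesis by simp
  qed
  finally have "sum ?t {..k} = (if even k then scalar (Norm (coeff f (k div 2))) else 0) +
      (\<Sum>i\<in>?L. scalar (Tr (?t i)))"
    by (simp add: scalar_Tr sum.distrib algebra_simps)
  then show ?thesis
    by (simp add: companion_coeff_eq scalar_add scalar_sum)
qed

lemma coeff_companion: "coeff (companion f) k = companion_coeff f k"
proof (cases "k \<le> 2 * degree f")
  case True
  then show ?thesis by (simp add: companion_def coeff_sum)
next
  case False
  have "scalar (companion_coeff f k) = 0"
    unfolding scalar_companion_coeff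
  proof (rule sum.neutral, rule ballI)
    fix i
    have "degree f < i \<or> degree f < k - i" using False by linarith
    then show "obar (coeff f i) \<otimes> coeff f (k - i) = 0" by (auto simp: coeff_eq_0)
  qed
  then have "companion_coeff f k = 0"
    using scalar_inject[of _ 0] by simp
  with False show ?thesis by (simp add: companion_def coeff_sum)
qed

lemma map_scalar_companion: "map_poly scalar (companion f) = map_poly obar f \<odot> f"
  by (simp add: poly_eq_iff coeff_companion scalar_companion_coeff coeff_opoly_mult)

lemma companion_map_omult:
  "companion (map_poly (\<lambda>y. y \<otimes> x) f) = smult (Norm x) (companion f)"
  by (simp add: poly_eq_iff coeff_companion companion_coeff_eq coeff_map_poly Norm_omult
      Tr_obar_omult_right sum_distrib_left algebra_simps)

text \<open>The convolution on the left is symmetric up to conjugation, so it is the trace of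
  \<open>map_poly obar f \<odot> f\<close> times \<open>x\<close>; the coefficients of the former are scalars and come out of
  the trace.\<close>

lemma opoly_mult_obar_linear_term:
  "map_poly obar f \<odot> map_poly (\<lambda>y. y \<otimes> x) f + map_poly obar (map_poly (\<lambda>y. y \<otimes> x) f) \<odot> f =
    map_poly ((\<cdot>) (Tr x)) (map_poly obar f \<odot> f)"
proof (rule poly_eqI)
  fix k
  let ?t = "\<lambda>i. obar (coeff f i) \<otimes> (coeff f (k - i) \<otimes> x)"
  have rev: "(\<Sum>i\<le>k. obar (coeff f i \<otimes> x) \<otimes> coeff f (k - i)) = (\<Sum>i\<le>k. obar (?t i))"
    by (rule sum.reindex_bij_witness[of _ "\<lambda>i. k - i" "\<lambda>i. k - i"]) (auto simp: obar_omult)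
  have "(\<Sum>i\<le>k. ?t i) + (\<Sum>i\<le>k. obar (?t i)) = scalar (\<Sum>i\<le>k. Tr (?t i))"
    by (simp only: scalar_sum scalar_Tr sum.distrib)
  also have "(\<Sum>i\<le>k. Tr (?t i)) = Tr ((\<Sum>i\<le>k. obar (coeff f i) \<otimes> coeff f (k - i)) \<otimes> x)"
    by (simp only: Tr_omult_assoc[symmetric] Tr_sum omult_sum)
  also have "\<dots> = companion_coeff f k * Tr x"
    by (simp add: scalar_companion_coeff[symmetric] Tr_simps)
  finally show "coeff (map_poly obar f \<odot> map_poly (\<lambda>y. y \<otimes> x) f +
        map_poly obar (map_poly (\<lambda>y. y \<otimes> x) f) \<odot> f) k =
      coeff (map_poly ((\<cdot>) (Tr x)) (map_poly obar f \<odot> f)) k"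
    by (simp add: coeff_opoly_mult coeff_map_poly rev scalar_companion_coeff[symmetric]
        scalar_mult[symmetric] mult.commute)
qed

text \<open>Expanding $\overline{f(x)(x-\lambda)}\cdot f(x)(x-\lambda)$ gives three groups of terms, whose
  factors $1$, $-\mathrm{Tr}(\lambda)$ and $\mathrm{Norm}(\lambda)$ are read off from the two preceding
  lemmas.\<close>

lemma companion_opoly_mult_linear:
  "companion (f \<odot> [:- x, \<one>:]) = companion f * char_poly x"
proof -
  let ?b = "map_poly obar f" and ?fx = "map_poly (\<lambda>y. y \<otimes> x) f"
  let ?c = "?b \<odot> f"
  have bar: "map_poly obar (pCons 0 f - ?fx) = pCons 0 ?b - map_poly obar ?fx"
    by (simp add: poly_eq_iff coeff_pCons obar_distribs split: nat.split)
  have "map_poly obar ?fx \<odot> ?fx = map_poly scalar (smult (Norm x) (companion f))"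
    by (simp only: map_scalar_companion[symmetric] companion_map_omult)
  also have "\<dots> = map_poly ((\<cdot>) (Norm x)) ?c"
    by (simp add: poly_eq_iff scalar_mult flip: map_scalar_companion)
  finally have norm: "map_poly obar ?fx \<odot> ?fx = map_poly ((\<cdot>) (Norm x)) ?c" .
  have "map_poly scalar (companion (f \<odot> [:- x, \<one>:])) =
      pCons 0 (pCons 0 ?c) - pCons 0 (?b \<odot> ?fx + map_poly obar ?fx \<odot> f) + map_poly obar ?fx \<odot> ?fx"
    unfolding map_scalar_companion opoly_mult_linear bar opoly_mult_distribs opoly_mult_pCons_0
    by (simp add: poly_eq_iff coeff_pCons split: nat.split)
  also have "\<dots> = char_poly_times x ?c"
    by (simp only: opoly_mult_obar_linear_term norm char_poly_times_def)
  also have "\<dots> = map_poly scalar (companion f * char_poly x)"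
    by (simp only: mult.commute[of "companion f"] map_scalar_char_poly_mult map_scalar_companion)
  finally show ?thesis by (simp add: map_scalar_inject)
qed

text \<open>Since \<open>companion\<close> is a quadratic map over the central polynomials, \<open>char_poly z\<close> divides the
  companion polynomial of \<open>f\<close> if and only if it divides that of the remainder of \<open>f\<close>. The
  difference of companion polynomials on the right is the polar form of \<open>h\<close> and \<open>r\<close>.\<close>

lemma companion_char_poly_times_add:
  "companion (char_poly_times z h + r) = companion r +
     char_poly z * (char_poly z * companion h + (companion (h + r) - companion h - companion r))"
proof -
  let ?h = "map_poly obar h" and ?r = "map_poly obar r"
  have add: "map_poly obar (f + g) = map_poly obar f + map_poly obar g" for f g
    by (simp add: poly_eq_iff obar_distribs)
  have "map_poly scalar (companion (h + r) - companion h - companion r) = ?h \<odot> r + ?r \<odot> h"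
    by (simp add: map_scalar_diff map_scalar_companion add opoly_mult_distribs)
  then have "map_poly scalar (companion (char_poly_times z h + r)) = map_poly scalar (companion r +
     char_poly z * (char_poly z * companion h + (companion (h + r) - companion h - companion r)))"
    by (simp only: map_scalar_companion map_scalar_add map_scalar_char_poly_mult add
        map_obar_char_poly_times opoly_mult_distribs char_poly_times_opoly_mult
        char_poly_times_add) simp
  then show ?thesis by (simp only: map_scalar_inject)
qed

lemma companion_linear: "companion [:b, a:] = [:Norm b, Tr (obar b \<otimes> a), Norm a:]"
proof -
  have l: "[:y, x:] \<odot> g = map_poly ((\<otimes>) y) g + pCons 0 (map_poly ((\<otimes>) x) g)" for x y g
  proof -
    have "[:y, x:] = [:y:] + pCons 0 [:x:]" by simp
    then show ?thesis by (simp only: opoly_mult_distribs opoly_mult_pCons_0 opoly_mult_const)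
  qed
  have "map_poly scalar (companion [:b, a:]) = [:obar b, obar a:] \<odot> [:b, a:]"
    by (simp add: map_scalar_companion map_poly_pCons)
  also have "\<dots> = [:obar b \<otimes> b, obar b \<otimes> a + obar a \<otimes> b, obar a \<otimes> a:]"
    by (simp add: l map_poly_pCons add.commute)
  also have "\<dots> = map_poly scalar [:Norm b, Tr (obar b \<otimes> a), Norm a:]"
    by (simp add: map_poly_pCons scalar_Norm scalar_Tr obar_omult)
  finally show ?thesis by (simp only: map_scalar_inject)
qed

lemma companion_const: "companion [:c:] = [:Norm c:]"
  using companion_linear[of c 0] by (simp add: Tr_simps)

section \<open>Evaluation and synthetic division\<close>

lemma ex_opower: "\<exists>p q. opower x i = p \<cdot> \<one> + q \<cdot> x"
proof (induction i)
  case 0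
  have "opower x 0 = 1 \<cdot> \<one> + 0 \<cdot> x" by simp
  then show ?case by blast
next
  case (Suc i)
  then obtain p q where "opower x i = p \<cdot> \<one> + q \<cdot> x" by blast
  then have "opower x (Suc i) = (- (q * Norm x)) \<cdot> \<one> + (p + q * Tr x) \<cdot> x"
    by (simp add: omult_distribs omult_self osmul_distribs)
  then show ?case by blast
qed

text \<open>This case of the associativity of two-generated subalgebras makes Horner evaluation possible;
  powers of \<open>x\<close> are combinations of \<open>\<one>\<close> and \<open>x\<close>, so it follows from the rule for
  \<open>y \<otimes> x \<otimes> x\<close>.\<close>

lemma omult_opower_Suc: "y \<otimes> opower x (Suc i) = y \<otimes> opower x i \<otimes> x"
proof -
  obtain p q where "opower x i = p \<cdot> \<one> + q \<cdot> x" using ex_opower by blast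
  then show ?thesis
    by (simp add: omult_distribs omult_self omult_omult_self)
qed

lemma oeval_0 [simp]: "oeval 0 x = 0"
  by (simp add: oeval_def)

lemma oeval_pCons: "oeval (pCons c f) x = c + oeval f x \<otimes> x"
proof (cases "f = 0")
  case False
  have "oeval (pCons c f) x = (\<Sum>i\<le>Suc (degree f). coeff (pCons c f) i \<otimes> opower x i)"
    using False by (simp add: oeval_def)
  also have "\<dots> = c + (\<Sum>i\<le>degree f. coeff f i \<otimes> opower x (Suc i))"
    by (simp only: sum.atMost_Suc_shift) simp
  also have "\<dots> = c + oeval f x \<otimes> x"
    by (simp only: omult_opower_Suc oeval_def omult_sum)
  finally show ?thesis .
qed (simp add: oeval_def)

lemma oeval_add: "oeval (f + g) x = oeval f x + oeval g x"
  by (induction f g rule: poly_induct2) (simp_all add: oeval_pCons omult_distribs)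

lemma oeval_osmul: "oeval (map_poly ((\<cdot>) a) f) x = a \<cdot> oeval f x"
  by (induction f) (simp_all add: oeval_pCons map_poly_pCons osmul_distribs)

lemma oeval_diff: "oeval (f - g) x = oeval f x - oeval g x"
  using oeval_add[of "f - g" g x] by simp

lemma oeval_char_poly_times:
  "oeval (char_poly_times z h) x = oeval h x \<otimes> (x \<otimes> x - Tr z \<cdot> x + Norm z \<cdot> \<one>)"
  by (simp add: char_poly_times_def oeval_add oeval_diff oeval_pCons oeval_osmul omult_distribs
      omult_self omult_omult_self)

lemma oeval_char_poly_times_self:
  "char_poly z = char_poly x \<Longrightarrow> oeval (char_poly_times z h) x = 0"
  by (simp add: oeval_char_poly_times char_poly_eq_iff omult_self)

text \<open>The coefficients of the quotient are the intermediate values of Horner evaluation at \<open>x\<close>.\<close>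

lemma synthetic_division: "\<exists>g. f = g \<odot> [:- x, \<one>:] + [:oeval f x:]"
proof (induction f)
  case 0
  have "0 = 0 \<odot> [:- x, \<one>:] + [:oeval 0 x:]" by (simp add: opoly_mult_linear)
  then show ?case by blast
next
  case (pCons c f)
  then obtain g where g: "f = g \<odot> [:- x, \<one>:] + [:oeval f x:]" by blast
  let ?e = "oeval f x"
  have "pCons ?e g \<odot> [:- x, \<one>:] = pCons (- (?e \<otimes> x)) (g \<odot> [:- x, \<one>:] + [:?e:])"
    by (simp add: opoly_mult_linear map_poly_pCons poly_eq_iff coeff_pCons split: nat.split)
  then have "pCons c f = pCons ?e g \<odot> [:- x, \<one>:] + [:oeval (pCons c f) x:]"
    using g by (simp add: oeval_pCons)
  then show ?case by blast
qed

section \<open>Products of linear factors\<close>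

lemma linear_product_0: "linear_product c lam 0 = [:c:]"
  by (simp add: linear_product_def)

lemma linear_product_Suc:
  "linear_product c lam (Suc n) = linear_product c (\<lambda>k. lam (Suc k)) n \<odot> [:- lam 1, \<one>:]"
proof -
  have "[1..<Suc (Suc n)] = 1 # map Suc [1..<Suc n]"
    by (simp add: map_Suc_upt upt_conv_Cons del: upt_Suc)
  then show ?thesis
    unfolding linear_product_def
    by (simp add: rev_map foldl_map del: upt_Suc)
qed

lemma linear_product_cong:
  assumes "\<And>k. k \<in> {1..n} \<Longrightarrow> lam k = lam' k"
  shows "linear_product c lam n = linear_product c lam' n"
  unfolding linear_product_def by (rule foldl_cong) (use assms in auto)

lemma prod_Suc_shift:
  fixes p :: "nat \<Rightarrow> 'f poly"
  shows "(\<Prod>k=1..Suc n. p k) = (\<Prod>k=1..n. p (Suc k)) * p 1"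
proof -
  have "(\<Prod>k=1..Suc n. p k) = p 1 * (\<Prod>k=Suc 1..Suc n. p k)"
    by (rule prod.atLeast_Suc_atMost) simp
  then show ?thesis
    by (simp only: prod.shift_bounds_cl_Suc_ivl mult.commute)
qed

lemma companion_linear_product:
  "companion (linear_product c lam n) = smult (Norm c) (\<Prod>k=1..n. char_poly (lam k))"
proof (induction n arbitrary: lam)
  case 0
  show ?case by (simp add: linear_product_0 companion_const)
next
  case (Suc n)
  show ?case
    by (simp only: linear_product_Suc companion_opoly_mult_linear Suc prod_Suc_shift) simp
qed

end

section \<open>Conjugacy classes in division algebras\<close>

context octonion_division_algebra begin

lemma Norm_eq_0_iff [simp]: "Norm z = 0 \<longleftrightarrow> z = 0"
proof
  assume 0: "Norm z = 0"
  show "z = 0"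
  proof (rule ccontr)
    assume "z \<noteq> 0"
    then obtain w where "z \<otimes> w = \<one>" using invertible by blast
    then have "Norm z * Norm w = 1" by (metis Norm_omult Norm_one)
    with 0 show False by simp
  qed
qed simp

lemma omult_eq_0_iff: "x \<otimes> y = 0 \<longleftrightarrow> x = 0 \<or> y = 0"
  by (simp only: Norm_eq_0_iff[symmetric] Norm_omult mult_eq_0_iff)

lemma omult_inverse:
  assumes "z \<noteq> 0"
  shows "z \<otimes> inverse (Norm z) \<cdot> obar z = \<one>" "inverse (Norm z) \<cdot> obar z \<otimes> z = \<one>"
    "y \<otimes> z \<otimes> inverse (Norm z) \<cdot> obar z = y"
  using assms by (simp_all add: omult_obar_self omult_obar_cancel_right)

lemma inner_conjugateI:
  assumes "z \<noteq> 0" "z \<otimes> a = b \<otimes> z"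
  shows "inner_conjugate a b"
proof -
  let ?w = "inverse (Norm z) \<cdot> obar z"
  have "b = z \<otimes> a \<otimes> ?w" using omult_inverse(3)[of z b] assms by simp
  then show ?thesis
    unfolding inner_conjugate_def using assms(1) omult_inverse(1,2)[of z] by blast
qed

text \<open>A trace-zero element \<open>z\<close> for which \<open>z \<otimes> a\<close> has trace zero as well satisfies
  $za = -\overline{za} = -\bar a \bar z = \bar a z$.  On elements \<open>(0, s)\<close> the first condition is
  automatic and the second one is linear in \<open>s\<close>.\<close>

lemma inner_conjugate_obar: "inner_conjugate a (obar a)"
proof -
  obtain q r where a: "a = (q, r)" by (cases a)
  obtain x where x: "bar x \<noteq> x" using ex_bar_neq by blast
  define y where "y = x - bar x"
  have y: "y \<noteq> 0" "y + bar y = 0" using x by (auto simp: y_def bar_diff bar_bar)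
  \<comment> \<open>The trace of \<open>bar r * (r * y)\<close> is \<open>qnorm r\<close> times that of \<open>y\<close>, which is zero.\<close>
  define s where "s = (if r = 0 then 1 else r * y)"
  have s: "s \<noteq> 0"
  proof
    assume "s = 0"
    then have r: "r \<noteq> 0" "r * y = 0" by (auto simp: s_def split: if_splits)
    then have "(r, 0) \<otimes> (y, 0) = 0" by (simp add: omult_def prod_eq_iff)
    with r y show False
      using omult_eq_0_iff[of "(r, 0)" "(y, 0)"] by (simp add: prod_eq_iff)
  qed
  have "qtr y = 0" by (rule qtr_eqI) (simp add: y)
  then have "qtr (bar r * s) = 0"
    by (auto simp: s_def bar_mult_cancel qtr_scale intro: qtr_eqI)
  let ?z = "(0, s)"
  have z: "?z \<noteq> 0" "obar ?z = - ?z" using s by (simp_all add: obar_def zero_prod_def)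
  have "Tr (?z \<otimes> a) = 0"
    by (simp add: a Tr_eq_qtr omult_def qtr_scale \<open>qtr (bar r * s) = 0\<close>)
  then have "?z \<otimes> a = - obar (?z \<otimes> a)"
    using scalar_Tr[of "?z \<otimes> a"] by (simp add: eq_neg_iff_add_eq_0)
  also have "\<dots> = obar a \<otimes> ?z"
    by (simp only: obar_omult z omult_distribs) simp
  finally show ?thesis by (rule inner_conjugateI[OF z(1)])
qed

text \<open>Trace and norm are invariant under conjugation because the trace is cyclic and the norm
  multiplicative. Conversely, if \<open>a\<close> and \<open>b\<close> have the same trace and norm, then
  \<open>z = b - obar a\<close> satisfies \<open>z \<otimes> a = b \<otimes> z\<close>; the preceding lemma covers the case that this
  \<open>z\<close> is zero.\<close>

lemma inner_conjugate_iff: "inner_conjugate a b \<longleftrightarrow> char_poly a = char_poly b"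
proof
  assume "inner_conjugate a b"
  then obtain z w where z: "z \<otimes> w = \<one>" "w \<otimes> z = \<one>" and b: "b = z \<otimes> a \<otimes> w"
    by (auto simp: inner_conjugate_def)
  have zw: "Norm z * Norm w = 1"
    using z by (metis Norm_omult Norm_one)
  have "Norm b = Norm a"
    using zw by (simp add: b Norm_omult algebra_simps)
  moreover have "Tr b = Tr (w \<otimes> (z \<otimes> a))"
    by (simp add: b Tr_omult_commute)
  then have "Tr b = Tr a"
    by (simp add: z Tr_omult_assoc[symmetric])
  ultimately show "char_poly a = char_poly b" by (simp add: char_poly_eq_iff)
next
  assume eq: "char_poly a = char_poly b"
  show "inner_conjugate a b"
  proof (cases "b = obar a")
    case True
    then show ?thesis by (simp add: inner_conjugate_obar)
  next
    case False
    have "(b - obar a) \<otimes> a = b \<otimes> a - Norm a \<cdot> \<one>"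
      by (simp add: omult_distribs omult_obar_self)
    also have "\<dots> = b \<otimes> (b - obar a)"
      using eq by (simp add: omult_distribs omult_self obar_eq char_poly_eq_iff)
    finally show ?thesis using False by (intro inner_conjugateI[of "b - obar a"]) auto
  qed
qed

lemma conjugacy_class_eq_iff: "conjugacy_class a = conjugacy_class b \<longleftrightarrow> char_poly a = char_poly b"
proof
  assume "conjugacy_class a = conjugacy_class b"
  then have "b \<in> conjugacy_class a" by (simp add: conjugacy_class_def inner_conjugate_iff)
  then show "char_poly a = char_poly b" by (simp add: conjugacy_class_def inner_conjugate_iff)
qed (simp add: conjugacy_class_def inner_conjugate_iff)

text \<open>Subtracting $x^2 - \mathrm{Tr}(x)x + \mathrm{Norm}(x) = 0$ from the assumption shows that \<open>x\<close> is a scalar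
  unless the coefficients agree. If \<open>x\<close> is a scalar, then the assumption factors as
  $(z - x)(\bar z - x) = 0$.\<close>

lemma char_poly_eq_if_annihilates:
  assumes "x \<otimes> x - Tr z \<cdot> x + Norm z \<cdot> \<one> = 0"
  shows "char_poly z = char_poly x"
proof (cases "Tr z = Tr x")
  case True
  with assms have "(Norm z - Norm x) \<cdot> \<one> = 0"
    by (simp add: omult_self osmul_distribs)
  then have "Norm z = Norm x"
    using scalar_inject[of "Norm z - Norm x" 0] by (simp add: scalar_eq_osmul)
  with True show ?thesis by (simp add: char_poly_eq_iff)
next
  case False
  have "(Tr x - Tr z) \<cdot> x = (Norm x - Norm z) \<cdot> \<one>"
    using assms by (simp add: omult_self osmul_distribs algebra_simps)
  from arg_cong[OF this, of "\<lambda>y. inverse (Tr x - Tr z) \<cdot> y"]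
  obtain s where x: "x = s \<cdot> \<one>" using False by auto
  have "(z - x) \<otimes> (obar z - x) = z \<otimes> obar z - s \<cdot> (z + obar z) + (s * s) \<cdot> \<one>"
    by (simp add: x omult_distribs osmul_distribs algebra_simps)
  also have "\<dots> = x \<otimes> x - Tr z \<cdot> x + Norm z \<cdot> \<one>"
    by (simp add: x omult_obar_self scalar_Tr[symmetric] scalar_eq_osmul mult.commute)
  finally have "(z - x) \<otimes> (obar z - x) = 0" using assms by simp
  then have "z = x \<or> obar z = x" by (simp add: omult_eq_0_iff)
  then have "z = x" by (metis x obar_simps(1,3,4))
  then show ?thesis by simp
qed

text \<open>The product vanishes at \<open>x\<close> and, as there are no zero divisors, so does one of its factors.
  This treats irreducible \<open>char_poly x\<close> and squares alike.\<close>

lemma char_poly_dvd_prod_mset: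
  assumes "char_poly x dvd prod_mset (image_mset char_poly M)"
  shows "\<exists>z\<in>#M. char_poly z = char_poly x"
proof -
  let ?p = "prod_mset (image_mset char_poly M)"
  obtain u where "?p = char_poly x * u" using assms by blast
  then have "oeval (map_poly scalar ?p) x = 0"
    by (simp add: map_scalar_char_poly_mult oeval_char_poly_times_self)
  then show ?thesis
  proof (induction M)
    case empty
    have "\<one> \<noteq> 0" by (simp add: oone_def zero_prod_def)
    with empty show ?case
      by (simp add: one_pCons map_poly_pCons scalar_one oeval_pCons)
  next
    case (add z M)
    from add.prems show ?case
      by (simp add: map_scalar_char_poly_mult oeval_char_poly_times omult_eq_0_iff)
        (use add.IH char_poly_eq_if_annihilates in blast)
  qed
qed

lemma char_poly_factorization_unique:
  assumes "prod_mset (image_mset char_poly M) = prod_mset (image_mset char_poly N)"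
  shows "image_mset char_poly M = image_mset char_poly N"
  using assms
proof (induction M arbitrary: N)
  case empty
  show ?case
  proof (cases N)
    case (add z N')
    with empty have "1 = char_poly z * prod_mset (image_mset char_poly N')" by simp
    then have "char_poly z dvd 1" by (rule dvdI)
    then show ?thesis using dvd_imp_degree_le[of "char_poly z" 1] by simp
  qed simp
next
  case (add x M)
  then have "char_poly x dvd prod_mset (image_mset char_poly N)"
    by (metis dvd_triv_left image_mset_add_mset prod_mset.add_mset)
  then obtain z where z: "z \<in># N" "char_poly z = char_poly x"
    using char_poly_dvd_prod_mset by blast
  then obtain N' where N: "N = add_mset z N'" by (meson mset_add)
  show ?case using add.prems add.IH[of N'] by (simp add: N z)
qed

section \<open>Roots and factorizations\<close>

text \<open>The remainder of \<open>f\<close> modulo \<open>char_poly z\<close> is some $ax + b$ whose companion polynomial, of degree at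
  most 2, is still divisible by \<open>char_poly z\<close> and thus is \<open>Norm a\<close> times it.  If \<open>a \<noteq> 0\<close>,
  then comparing coefficients shows that $-a^{-1}b$ has the trace and the norm of \<open>z\<close>, and so it annihilates both \<open>char_poly z\<close> and the
  remainder.  If \<open>a = 0\<close>, then also \<open>b = 0\<close>, and \<open>z\<close> itself is a root.\<close>

lemma ex_root_if_char_poly_dvd_companion:
  assumes "char_poly z dvd companion f"
  shows "\<exists>x. oeval f x = 0 \<and> char_poly x = char_poly z"
proof -
  obtain h a b where f: "f = char_poly_times z h + [:b, a:]" using ex_char_poly_division by blast
  let ?r = "[:b, a:]"
  have "char_poly z dvd companion ?r"
    using assms by (simp add: f companion_char_poly_times_add dvd_add_left_iff)
  then obtain p where p: "companion ?r = char_poly z * p" by blast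
  have "degree p = 0"
  proof (cases "p = 0")
    case False
    then have "2 + degree p = degree (companion ?r)" by (simp add: p degree_mult_eq)
    also have "\<dots> \<le> 2" by (simp add: companion_linear)
    finally show ?thesis by simp
  qed simp
  then obtain k where "p = [:k:]" by (rule degree_eq_zeroE)
  with p have *: "Norm b = k * Norm z" "Tr (obar b \<otimes> a) = - (k * Tr z)" "Norm a = k"
    by (auto simp: companion_linear char_poly_def)
  show ?thesis
  proof (cases "k = 0")
    case True
    with * have "a = 0" "b = 0" by simp_all
    then show ?thesis by (intro exI[of _ z]) (simp add: f oeval_char_poly_times_self)
  next
    case False
    \<comment> \<open>This is $-a^{-1}b$, since the inverse of \<open>a\<close> is \<open>inverse (Norm a) \<cdot> obar a\<close>.\<close>
    define x where "x = - (inverse k \<cdot> (obar a \<otimes> b))"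
    have "a \<otimes> x = - b"
      using False *(3) by (simp add: x_def omult_distribs omult_obar_cancel_left)
    then have r: "oeval ?r x = 0" by (simp add: oeval_pCons)
    have "Norm x = inverse k * inverse k * (k * (k * Norm z))"
      by (simp add: x_def * Norm_minus Norm_osmul Norm_omult Norm_obar)
    then have "Norm x = Norm z" using False by (simp add: field_simps)
    moreover have "Tr (obar a \<otimes> b) = Tr (obar b \<otimes> a)"
      using Tr_simps(3)[of "obar a \<otimes> b"] by (simp add: obar_omult)
    then have "Tr x = Tr z"
      using False * by (simp add: x_def Tr_minus Tr_simps)
    ultimately have "char_poly x = char_poly z" by (simp add: char_poly_eq_iff)
    with r show ?thesis by (intro exI[of _ x]) (simp add: f oeval_add oeval_char_poly_times_self)
  qed
qed

lemma linear_factor_if_root: "oeval f x = 0 \<Longrightarrow> \<exists>g. f = g \<odot> [:- x, \<one>:]"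
  using synthetic_division[of f x] by auto

text \<open>A quadratic factor of \<open>companion f\<close> yields a root of \<open>f\<close> in its class.  Splitting off the
  corresponding linear factor on the right removes exactly that quadratic factor, and the
  quotient is subject to the induction hypothesis.\<close>

lemma ex_linear_product:
  assumes "degree f = n" "lead_coeff f = c" "c \<noteq> 0"
    and "companion f = smult (Norm c) (\<Prod>k=1..n. char_poly (gam k))"
  shows "\<exists>lam. f = linear_product c lam n"
  using assms
proof (induction n arbitrary: f)
  case 0
  then show ?case by (auto simp: linear_product_0 elim: degree_eq_zeroE)
next
  case (Suc n)
  let ?m = "char_poly (gam (Suc n))"
  have C: "companion f = smult (Norm c) (\<Prod>k=1..n. char_poly (gam k)) * ?m"
    using Suc.prems by simp
  then have "?m dvd companion f" by (simp only: C dvd_triv_right)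
  then obtain x where x: "oeval f x = 0" "char_poly x = ?m"
    using ex_root_if_char_poly_dvd_companion by blast
  then obtain g where g: "f = g \<odot> [:- x, \<one>:]" using linear_factor_if_root by blast
  have "g \<noteq> 0" using Suc.prems g by (auto simp: opoly_mult_linear)
  then have "degree g = n" "lead_coeff g = c"
    using Suc.prems degree_opoly_mult_linear[of g x] g by auto
  moreover have "companion g * ?m = smult (Norm c) (\<Prod>k=1..n. char_poly (gam k)) * ?m"
    using C by (simp only: g companion_opoly_mult_linear x)
  then have "companion g = smult (Norm c) (\<Prod>k=1..n. char_poly (gam k))"
    by (subst (asm) mult_cancel_right) simp
  ultimately obtain lam where lam: "g = linear_product c lam n"
    using Suc.IH \<open>c \<noteq> 0\<close> by blast
  let ?l = "\<lambda>k. if k = 1 then x else lam (k - 1)"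
  \<comment> \<open>The shifted sequence may differ from \<open>lam\<close> at index 0, which the product does not involve.\<close>
  have "linear_product c (\<lambda>k. ?l (Suc k)) n = linear_product c lam n"
    by (rule linear_product_cong) simp
  then have "f = linear_product c ?l (Suc n)"
    unfolding linear_product_Suc by (simp add: g lam)
  then show ?case by blast
qed

lemma conjugacy_class_roots_linear_product:
  assumes "c \<noteq> 0" and f: "f = linear_product c lam n"
  shows "conjugacy_class ` oroots f = conjugacy_class ` lam ` {1..n}"
proof -
  let ?p = "\<Prod>k=1..n. char_poly (lam k)"
  have C: "companion f = smult (Norm c) ?p"
    unfolding f by (rule companion_linear_product)
  have p: "?p = prod_mset (image_mset char_poly (image_mset lam (mset_set {1..n})))"
    by (simp add: prod_unfold_prod_mset image_mset.compositionality o_def)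
  have 1: "\<exists>k\<in>{1..n}. char_poly (lam k) = char_poly x" if root: "oeval f x = 0" for x
  proof -
    obtain g where "f = g \<odot> [:- x, \<one>:]" using linear_factor_if_root[OF root] by blast
    then have "char_poly x dvd companion f" by (simp add: companion_opoly_mult_linear)
    then have "char_poly x dvd ?p" using \<open>c \<noteq> 0\<close> by (simp add: C dvd_smult_iff)
    then obtain z where "z \<in># image_mset lam (mset_set {1..n})" "char_poly z = char_poly x"
      unfolding p using char_poly_dvd_prod_mset by blast
    then show ?thesis by auto
  qed
  have 2: "\<exists>x. oeval f x = 0 \<and> char_poly x = char_poly (lam k)" if "k \<in> {1..n}" for k
  proof (rule ex_root_if_char_poly_dvd_companion)
    show "char_poly (lam k) dvd companion f"
      unfolding C using that by (intro dvd_smult dvd_prodI) auto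
  qed
  show ?thesis
  proof (intro equalityI image_subsetI)
    fix x assume "x \<in> oroots f"
    then obtain k where "k \<in> {1..n}" "conjugacy_class x = conjugacy_class (lam k)"
      using 1[of x] by (auto simp: oroots_def conjugacy_class_eq_iff)
    then show "conjugacy_class x \<in> conjugacy_class ` lam ` {1..n}" by blast
  next
    fix y assume "y \<in> lam ` {1..n}"
    then obtain k where k: "k \<in> {1..n}" "y = lam k" by blast
    obtain x where "oeval f x = 0" "conjugacy_class y = conjugacy_class x"
      using 2[OF k(1)] by (auto simp: k conjugacy_class_eq_iff)
    then show "conjugacy_class y \<in> conjugacy_class ` oroots f" by (simp add: oroots_def)
  qed
qed

lemma ex_permutation_inner_conjugate:
  fixes gam lam :: "nat \<Rightarrow> _"
  assumes "(\<Prod>k=1..n. char_poly (gam k)) = (\<Prod>k=1..n. char_poly (lam k))"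
  shows "\<exists>\<sigma>. \<sigma> permutes {1..n} \<and> (\<forall>k\<in>{1..n}. inner_conjugate (gam k) (lam (\<sigma> k)))"
proof -
  have p: "(\<Prod>k=1..n. char_poly (l k)) = prod_mset (image_mset char_poly (image_mset l (mset_set {1..n})))" for l
    by (simp add: prod_unfold_prod_mset image_mset.compositionality o_def)
  have "image_mset (\<lambda>k. char_poly (gam k)) (mset_set {1..n})
      = image_mset (\<lambda>k. char_poly (lam k)) (mset_set {1..n})"
    using char_poly_factorization_unique[OF assms[unfolded p]]
    by (simp add: image_mset.compositionality o_def)
  then obtain \<sigma> where "\<sigma> permutes {1..n}" "\<forall>k\<in>{1..n}. char_poly (gam k) = char_poly (lam (\<sigma> k))"
    by (rule image_mset_eq_implies_permutes[OF finite_atLeastAtMost])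
  then show ?thesis by (auto simp: inner_conjugate_iff)
qed

end

theorem theorem3p2:
  fixes scale :: "'f::field \<Rightarrow> 'q::ring_1 \<Rightarrow> 'q" and bar :: "'q \<Rightarrow> 'q" and \<gamma>\<^sub>0 :: 'f
    and n :: nat and c :: "'q \<times> 'q" and f :: "('q \<times> 'q) poly"
  assumes "octonion_division_algebra scale bar \<gamma>\<^sub>0"
    and "n \<ge> 1" and "degree f = n" and "lead_coeff f = c" and "c \<noteq> 0"
  shows "((\<exists>lam. f = octonion_algebra.linear_product scale bar \<gamma>\<^sub>0 c lam n) \<longleftrightarrow>
      (\<exists>gam. octonion_algebra.companion scale bar \<gamma>\<^sub>0 f =
        smult (octonion_algebra.Norm scale bar \<gamma>\<^sub>0 c)
          (\<Prod>k=1..n. [:octonion_algebra.Norm scale bar \<gamma>\<^sub>0 (gam k), - octonion_algebra.Tr scale bar (gam k), 1:]))) \<and>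
    (\<forall>lam gam. f = octonion_algebra.linear_product scale bar \<gamma>\<^sub>0 c lam n \<and>
      octonion_algebra.companion scale bar \<gamma>\<^sub>0 f =
        smult (octonion_algebra.Norm scale bar \<gamma>\<^sub>0 c)
          (\<Prod>k=1..n. [:octonion_algebra.Norm scale bar \<gamma>\<^sub>0 (gam k), - octonion_algebra.Tr scale bar (gam k), 1:]) \<longrightarrow>
      (\<exists>\<sigma>. \<sigma> permutes {1..n} \<and>
        (\<forall>k\<in>{1..n}. octonion_algebra.inner_conjugate scale bar \<gamma>\<^sub>0 (gam k) (lam (\<sigma> k)))) \<and>
      octonion_algebra.conjugacy_class scale bar \<gamma>\<^sub>0 ` octonion_algebra.oroots scale bar \<gamma>\<^sub>0 f =
        octonion_algebra.conjugacy_class scale bar \<gamma>\<^sub>0 ` lam ` {1..n})"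
proof -
  interpret octonion_division_algebra scale bar \<gamma>\<^sub>0 by fact
  have companion: "companion f = smult (Norm c) (\<Prod>k=1..n. char_poly (lam k))"
    if "f = linear_product c lam n" for lam
    using that companion_linear_product by simp
  have permutation: "\<exists>\<sigma>. \<sigma> permutes {1..n} \<and> (\<forall>k\<in>{1..n}. inner_conjugate (gam k) (lam (\<sigma> k)))"
    if "f = linear_product c lam n" "companion f = smult (Norm c) (\<Prod>k=1..n. char_poly (gam k))"
    for lam gam
  proof (rule ex_permutation_inner_conjugate)
    show "(\<Prod>k=1..n. char_poly (gam k)) = (\<Prod>k=1..n. char_poly (lam k))"
      using companion[OF that(1)] that(2) \<open>c \<noteq> 0\<close> by (simp add: smult_eq_iff)
  qed
  show ?thesis
    unfolding char_poly_def[symmetric]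
  proof (intro conjI allI impI)
    show "(\<exists>lam. f = linear_product c lam n) \<longleftrightarrow>
        (\<exists>gam. companion f = smult (Norm c) (\<Prod>k=1..n. char_poly (gam k)))"
    proof
      assume "\<exists>lam. f = linear_product c lam n"
      then obtain lam where "f = linear_product c lam n" by blast
      then show "\<exists>gam. companion f = smult (Norm c) (\<Prod>k=1..n. char_poly (gam k))"
        by (intro exI[of _ lam] companion)
    next
      assume "\<exists>gam. companion f = smult (Norm c) (\<Prod>k=1..n. char_poly (gam k))"
      then obtain gam where "companion f = smult (Norm c) (\<Prod>k=1..n. char_poly (gam k))" by blast
      then show "\<exists>lam. f = linear_product c lam n"
        by (rule ex_linear_product[OF assms(3-5)])
    qed
  next
    fix lam gam
    assume *: "f = linear_product c lam n \<and>
      companion f = smult (Norm c) (\<Prod>k=1..n. char_poly (gam k))"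
    then show "\<exists>\<sigma>. \<sigma> permutes {1..n} \<and> (\<forall>k\<in>{1..n}. inner_conjugate (gam k) (lam (\<sigma> k)))"
      by (intro permutation) auto
    from * show "conjugacy_class ` oroots f = conjugacy_class ` lam ` {1..n}"
      by (intro conjugacy_class_roots_linear_product[OF \<open>c \<noteq> 0\<close>]) auto
  qed
qed

end
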